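(* Let $p\geq 3$ be a prime and let $H_p$ be the Heisenberg group over $\mathbb Z_p$, presented as $H_p=\{x^ay^bz^c: 0\leq a,b,c<p\}$ with relations $x^p=y^p=z^p=1$, $xz=zx$, $yz=zy$, $yx=xyz$. For $$F=\sum_{0\leq i,j,k<p}a_{ijk}\,x^iy^jz^k\in\mathbb Z[H_p],\qquad a_{ijk}\in\mathbb Z,$$ let $M_{H_p}(F)=\det\big(a_{gh^{-1}}\big)_{g,h\in H_p}$ be the group determinant of $H_p$ evaluated at the coefficients of $F$ (where $a_g=a_{ijk}$ for $g=x^iy^jz^k$). Then $$M_{H_p}(F)\equiv F(1,1,1)^{p^3}\pmod{p^3},$$ where $F(1,1,1)=\sum_{i,j,k}a_{ijk}$.
   Context: For a finite group $G=\{g_1,\dots,g_k\}$ and integers $a_g$, the group determinant is $\det(a_{g_ig_j^{-1}})_{1\le i,j\le k}$. $H_p$ is the group of $3\times3$ upper unitriangular matrices over $\mathbb Z_p$. *)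

theory Defs
  imports
    "Jordan_Normal_Form.Determinant"
    "HOL-Algebra.Group"
    "HOL-Number_Theory.Cong"
begin

text \<open>
  The residue ring modulo \<open>p\<close> is represented by the integers \<open>0, \<dots>, p - 1\<close>, so the group is
  carried by integer matrices with entries in that range, multiplied and then reduced entrywise.
\<close>

definition heisenberg :: "nat \<Rightarrow> int mat monoid" where
  "heisenberg p =
    \<lparr> carrier = {A \<in> carrier_mat 3 3. upper_triangular A \<and> (\<forall>i<3. A $$ (i, i) = 1)
                   \<and> elements_mat A \<subseteq> {0..<int p}},
      monoid.mult = (\<lambda>A B. map_mat (\<lambda>t. t mod int p) (A * B)),
      one = 1\<^sub>m 3 \<rparr>"

text \<open>
  An element of the group ring of \<open>G\<close> is represented by its coefficient function. The list
  \<open>gs\<close> enumerates \<open>carrier G\<close> without repetition.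
\<close>

definition group_det ::
    "('g, 'm) monoid_scheme \<Rightarrow> 'g list \<Rightarrow> ('g \<Rightarrow> 'a) \<Rightarrow> 'a::comm_ring_1" where
  "group_det G gs f =
     det (mat (length gs) (length gs) (\<lambda>(i, j). f (gs ! i \<otimes>\<^bsub>G\<^esub> inv\<^bsub>G\<^esub> (gs ! j))))"

text \<open>
  The coefficient function of \<open>\<Sum> a i j k x\<^sup>i y\<^sup>j z\<^sup>k\<close> over \<open>0 \<le> i, j, k < p\<close>: terms with the same
  underlying group element are added, as in the group ring.
\<close>

definition group_ring_elem ::
    "('g, 'm) monoid_scheme \<Rightarrow> nat \<Rightarrow> 'g \<Rightarrow> 'g \<Rightarrow> 'g \<Rightarrow> (nat \<Rightarrow> nat \<Rightarrow> nat \<Rightarrow> 'a::comm_ring_1) \<Rightarrow> 'g \<Rightarrow> 'a"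
  where
  "group_ring_elem G p x y z a g =
     (\<Sum>i<p. \<Sum>j<p. \<Sum>k<p.
        if x [^]\<^bsub>G\<^esub> i \<otimes>\<^bsub>G\<^esub> y [^]\<^bsub>G\<^esub> j \<otimes>\<^bsub>G\<^esub> z [^]\<^bsub>G\<^esub> k = g then a i j k else 0)"

subsection \<open>The group and its presentation\<close>

definition unitri :: "int \<Rightarrow> int \<Rightarrow> int \<Rightarrow> int mat" where
  "unitri a b c = mat_of_rows_list 3 [[1, a, c], [0, 1, b], [0, 0, 1]]"

lemma unitri_dim [simp]: "dim_row (unitri a b c) = 3" "dim_col (unitri a b c) = 3"
  by (auto simp: unitri_def mat_of_rows_list_def)

lemma less_3_cases: "i < (3::nat) \<longleftrightarrow> i = 0 \<or> i = 1 \<or> i = 2"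
  by auto

lemma unitri_index [simp]:
  "unitri a b c $$ (0, 0) = 1" "unitri a b c $$ (0, Suc 0) = a" "unitri a b c $$ (0, 2) = c"
  "unitri a b c $$ (Suc 0, 0) = 0" "unitri a b c $$ (Suc 0, Suc 0) = 1" "unitri a b c $$ (Suc 0, 2) = b"
  "unitri a b c $$ (2, 0) = 0" "unitri a b c $$ (2, Suc 0) = 0" "unitri a b c $$ (2, 2) = 1"
  by (auto simp: unitri_def mat_of_rows_list_def)

lemma unitri_eq_iff [simp]:
  "unitri a b c = unitri a' b' c' \<longleftrightarrow> a = a' \<and> b = b' \<and> c = c'"
  by (metis unitri_index(2,3,6))

lemma unitri_mult:
  assumes "p > 1"
  shows "unitri a b c \<otimes>\<^bsub>heisenberg p\<^esub> unitri a' b' c' =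
           unitri ((a + a') mod int p) ((b + b') mod int p) ((c + c' + a * b') mod int p)"
proof (rule eq_matI)
  have sum3: "(\<Sum>k = 0..<3. f k) = f 0 + f (Suc 0) + f 2" for f :: "nat \<Rightarrow> int"
    by (simp add: eval_nat_numeral)
  have p1: "1 mod int p = 1"
    using assms by simp
  fix i j
  assume "i < dim_row (unitri ((a + a') mod int p) ((b + b') mod int p) ((c + c' + a * b') mod int p))"
    and "j < dim_col (unitri ((a + a') mod int p) ((b + b') mod int p) ((c + c' + a * b') mod int p))"
  then have ij: "i < 3" "j < 3"
    by simp_all
  then have "(unitri a b c \<otimes>\<^bsub>heisenberg p\<^esub> unitri a' b' c') $$ (i, j) =
      (\<Sum>k = 0..<3. unitri a b c $$ (i, k) * unitri a' b' c' $$ (k, j)) mod int p"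
    by (simp add: heisenberg_def scalar_prod_def)
  with ij show "(unitri a b c \<otimes>\<^bsub>heisenberg p\<^esub> unitri a' b' c') $$ (i, j) =
      unitri ((a + a') mod int p) ((b + b') mod int p) ((c + c' + a * b') mod int p) $$ (i, j)"
    unfolding less_3_cases sum3 by (auto simp: p1 ac_simps)
qed (simp_all add: heisenberg_def)

lemma unitri_one: "\<one>\<^bsub>heisenberg p\<^esub> = unitri 0 0 0"
  by (rule eq_matI) (auto simp: heisenberg_def less_3_cases)

lemma carrier_heisenberg:
  assumes "p > 1"
  shows "carrier (heisenberg p) =
           (\<lambda>(a, b, c). unitri a b c) ` ({0..<int p} \<times> {0..<int p} \<times> {0..<int p})"
    (is "_ = ?R")
proof (intro equalityI subsetI)
  fix A assume "A \<in> carrier (heisenberg p)"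
  then have A: "A \<in> carrier_mat 3 3" "upper_triangular A" "\<And>i. i < 3 \<Longrightarrow> A $$ (i, i) = 1"
    "elements_mat A \<subseteq> {0..<int p}"
    by (auto simp: heisenberg_def)
  have "A = unitri (A $$ (0, 1)) (A $$ (1, 2)) (A $$ (0, 2))"
    using A(1) A(3)[of 0] A(3)[of 1] A(3)[of 2] upper_triangularD[OF A(2)]
    by (intro eq_matI) (auto simp: less_3_cases)
  moreover have "A $$ (i, j) \<in> {0..<int p}" if "i < 3" "j < 3" for i j
    using A(1,4) that elements_matI[OF A(1) that refl] by blast
  ultimately show "A \<in> ?R"
    by (intro image_eqI[of _ _ "(A $$ (0, 1), A $$ (1, 2), A $$ (0, 2))"]) auto
next
  fix A assume "A \<in> ?R"
  moreover have "upper_triangular (unitri a b c)" for a b c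
    by (rule upper_triangularI) (auto simp: less_3_cases less_2_cases_iff)
  ultimately show "A \<in> carrier (heisenberg p)"
    using assms by (auto simp: heisenberg_def elements_mat_def less_3_cases)
qed

lemma finite_carrier_heisenberg: "p > 1 \<Longrightarrow> finite (carrier (heisenberg p))"
  by (simp add: carrier_heisenberg)

lemma card_carrier_heisenberg: "p > 1 \<Longrightarrow> card (carrier (heisenberg p)) = p ^ 3"
  by (subst carrier_heisenberg)
    (auto simp: card_image inj_on_def card_cartesian_product power3_eq_cube)

lemma unitri_in_carrier:
  assumes "p > 1" "a \<in> {0..<int p}" "b \<in> {0..<int p}" "c \<in> {0..<int p}"
  shows "unitri a b c \<in> carrier (heisenberg p)"
  using assms by (auto simp: carrier_heisenberg intro!: image_eqI[of _ _ "(a, b, c)"])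

lemma group_heisenberg:
  assumes p: "p > 1"
  shows "group (heisenberg p)"
proof (rule groupI)
  fix A B C
  assume "A \<in> carrier (heisenberg p)" "B \<in> carrier (heisenberg p)" "C \<in> carrier (heisenberg p)"
  then obtain a b c a' b' c' a'' b'' c''
    where ABC: "A = unitri a b c" "B = unitri a' b' c'" "C = unitri a'' b'' c''"
    using p by (auto simp: carrier_heisenberg)
  have m: "[t mod int p = t] (mod int p)" for t
    by (simp add: cong_def)
  have "[c'' + (b'' * ((a + a') mod int p) + (c + (c' + a * b')) mod int p)
      = c'' + (b'' * (a + a') + (c + (c' + a * b')))] (mod int p)"
    by (intro cong_add cong_mult cong_refl m)
  moreover have "[c + (a * ((b' + b'') mod int p) + (c' + (c'' + a' * b'')) mod int p)
      = c + (a * (b' + b'') + (c' + (c'' + a' * b'')))] (mod int p)"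
    by (intro cong_add cong_mult cong_refl m)
  ultimately have "(c'' + (b'' * ((a + a') mod int p) + (c + (c' + a * b')) mod int p)) mod int p
      = (c + (a * ((b' + b'') mod int p) + (c' + (c'' + a' * b'')) mod int p)) mod int p"
    by (simp add: cong_def algebra_simps)
  then show "A \<otimes>\<^bsub>heisenberg p\<^esub> B \<otimes>\<^bsub>heisenberg p\<^esub> C = A \<otimes>\<^bsub>heisenberg p\<^esub> (B \<otimes>\<^bsub>heisenberg p\<^esub> C)"
    by (simp add: ABC unitri_mult[OF p] mod_simps ac_simps)
next
  fix A assume "A \<in> carrier (heisenberg p)"
  then obtain a b c where A: "A = unitri a b c"
    using p by (auto simp: carrier_heisenberg)
  have m: "[t mod int p = t] (mod int p)" for t
    by (simp add: cong_def)
  have "[(a * b - c) mod int p + c + - a mod int p * b = (a * b - c) + c + - a * b] (mod int p)"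
    by (intro cong_add cong_mult cong_refl m)
  then have "((a * b - c) mod int p + c + - a mod int p * b) mod int p = 0"
    by (simp add: cong_def)
  then have "unitri ((- a) mod int p) ((- b) mod int p) ((a * b - c) mod int p)
          \<otimes>\<^bsub>heisenberg p\<^esub> A = \<one>\<^bsub>heisenberg p\<^esub>"
    using p by (simp add: A unitri_mult unitri_one mod_simps)
  then show "\<exists>B\<in>carrier (heisenberg p). B \<otimes>\<^bsub>heisenberg p\<^esub> A = \<one>\<^bsub>heisenberg p\<^esub>"
    by (rule bexI) (rule unitri_in_carrier, use p in simp_all)
next
  fix A B assume "A \<in> carrier (heisenberg p)" "B \<in> carrier (heisenberg p)"
  then obtain a b c a' b' c' where "A = unitri a b c" "B = unitri a' b' c'"
    using p by (auto simp: carrier_heisenberg)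
  then show "A \<otimes>\<^bsub>heisenberg p\<^esub> B \<in> carrier (heisenberg p)"
    by (simp only: unitri_mult[OF p], intro unitri_in_carrier) (use p in simp_all)
next
  show "\<one>\<^bsub>heisenberg p\<^esub> \<in> carrier (heisenberg p)"
    unfolding unitri_one by (rule unitri_in_carrier) (use p in simp_all)
next
  fix A assume "A \<in> carrier (heisenberg p)"
  then show "\<one>\<^bsub>heisenberg p\<^esub> \<otimes>\<^bsub>heisenberg p\<^esub> A = A"
    using p by (auto simp: carrier_heisenberg unitri_one unitri_mult)
qed

lemma unitri_pow:
  assumes "p > 1"
  shows "unitri 0 1 0 [^]\<^bsub>heisenberg p\<^esub> n = unitri 0 (int n mod int p) 0"
    and "unitri 1 0 0 [^]\<^bsub>heisenberg p\<^esub> n = unitri (int n mod int p) 0 0"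
    and "unitri 0 0 1 [^]\<^bsub>heisenberg p\<^esub> n = unitri 0 0 (int n mod int p)"
  by (induction n) (simp_all add: unitri_one unitri_mult[OF assms] mod_simps add.commute)

text \<open>The relation \<open>y x = x y z\<close> fixes which elementary matrix plays the role of \<open>x\<close>.\<close>

lemma heisenberg_presentation:
  fixes p :: nat
  defines "H \<equiv> heisenberg p"
  defines "x \<equiv> unitri 0 1 0" and "y \<equiv> unitri 1 0 0" and "z \<equiv> unitri 0 0 1"
  assumes p: "p > 1"
  shows "x \<in> carrier H" "y \<in> carrier H" "z \<in> carrier H"
    and "x [^]\<^bsub>H\<^esub> p = \<one>\<^bsub>H\<^esub>" "y [^]\<^bsub>H\<^esub> p = \<one>\<^bsub>H\<^esub>" "z [^]\<^bsub>H\<^esub> p = \<one>\<^bsub>H\<^esub>"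
    and "x \<otimes>\<^bsub>H\<^esub> z = z \<otimes>\<^bsub>H\<^esub> x" "y \<otimes>\<^bsub>H\<^esub> z = z \<otimes>\<^bsub>H\<^esub> y" "y \<otimes>\<^bsub>H\<^esub> x = x \<otimes>\<^bsub>H\<^esub> y \<otimes>\<^bsub>H\<^esub> z"
    and "carrier H =
           {x [^]\<^bsub>H\<^esub> i \<otimes>\<^bsub>H\<^esub> y [^]\<^bsub>H\<^esub> j \<otimes>\<^bsub>H\<^esub> z [^]\<^bsub>H\<^esub> k | i j k. i < p \<and> j < p \<and> k < p}"
proof -
  have prod: "x [^]\<^bsub>H\<^esub> i \<otimes>\<^bsub>H\<^esub> y [^]\<^bsub>H\<^esub> j \<otimes>\<^bsub>H\<^esub> z [^]\<^bsub>H\<^esub> k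
      = unitri (int j) (int i) (int k)" if "i < p" "j < p" "k < p" for i j k :: nat
    using p that by (simp add: H_def x_def y_def z_def unitri_pow unitri_mult)
  show "carrier H =
      {x [^]\<^bsub>H\<^esub> i \<otimes>\<^bsub>H\<^esub> y [^]\<^bsub>H\<^esub> j \<otimes>\<^bsub>H\<^esub> z [^]\<^bsub>H\<^esub> k | i j k. i < p \<and> j < p \<and> k < p}"
    (is "_ = ?R")
  proof (intro equalityI subsetI)
    fix A assume "A \<in> carrier H"
    then obtain a b c where abc: "A = unitri a b c"
      "a \<in> {0..<int p}" "b \<in> {0..<int p}" "c \<in> {0..<int p}"
      using p by (auto simp: carrier_heisenberg H_def)
    define i j k where "i = nat b" and "j = nat a" and "k = nat c"
    with abc have "A = unitri (int j) (int i) (int k)" "i < p" "j < p" "k < p"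
      by (auto simp: nat_less_iff)
    then have "A = x [^]\<^bsub>H\<^esub> i \<otimes>\<^bsub>H\<^esub> y [^]\<^bsub>H\<^esub> j \<otimes>\<^bsub>H\<^esub> z [^]\<^bsub>H\<^esub> k" "i < p" "j < p" "k < p"
      by (simp_all add: prod)
    then show "A \<in> ?R" by blast
  next
    fix A assume "A \<in> ?R"
    then obtain i j k where "i < p" "j < p" "k < p" "A = unitri (int j) (int i) (int k)"
      using prod by auto
    then show "A \<in> carrier H"
      using p unitri_in_carrier by (auto simp: H_def)
  qed
qed (use p in \<open>auto simp: H_def x_def y_def z_def unitri_in_carrier unitri_pow unitri_mult unitri_one\<close>)

end

theory Submission
  imports
    Defs
    "Jordan_Normal_Form.Schur_Decomposition"
    "HOL-Computational_Algebra.Computational_Algebra"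
begin

text \<open>
  Let \<open>A\<close> be the group matrix of a function \<open>f\<close> on a group \<open>G\<close> of order \<open>n = p\<^sup>m\<close> and exponent
  \<open>p\<close>, and let \<open>s = \<Sum> f\<close>. The trace of \<open>A\<^sup>k\<close> is \<open>n (s\<^sup>k - d\<^sub>k)\<close>, where \<open>d\<^sub>k\<close> is the total weight of
  the words of length \<open>k\<close> in \<open>G\<close> with product different from 1. If \<open>p\<^sup>v\<close> divides \<open>k\<close>, rotation by
  \<open>k / p\<^sup>v\<close> letters acts freely on these words, since the product of a word \<open>u\<^sup>p\<close> is 1; hence \<open>p\<^sup>v\<close>
  divides \<open>d\<^sub>k\<close>, and \<open>d\<^sub>k / k\<close> is \<open>p\<close>-integral. Taking logarithms,
  \<open>det (1 - A X) = (1 - s X)\<^sup>n exp (n \<Sum> d\<^sub>k / k X\<^sup>k)\<close>, and the exponential is congruent to 1 modulo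
  \<open>p\<^sup>m\<close>. Comparing coefficients of \<open>X\<^sup>n\<close> gives \<open>det A \<equiv> s\<^sup>n\<close>.
\<close>

section \<open>Words with nontrivial product\<close>

text \<open>Every orbit has exactly \<open>q\<close> elements, and the weight is constant on it, so
  it contributes a multiple of \<open>q\<close>. Removing one orbit leaves a smaller set that still
  satisfies all hypotheses.\<close>

lemma dvd_sum_of_free_cyclic_action:
  fixes w :: "'a \<Rightarrow> int"
  assumes "finite S" and "q > 0"
    and "\<And>x. x \<in> S \<Longrightarrow> r x \<in> S"
    and "\<And>x. x \<in> S \<Longrightarrow> (r ^^ q) x = x"
    and "\<And>x i. x \<in> S \<Longrightarrow> 0 < i \<Longrightarrow> i < q \<Longrightarrow> (r ^^ i) x \<noteq> x"
    and "\<And>x. x \<in> S \<Longrightarrow> w (r x) = w x"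
  shows "int q dvd (\<Sum>x\<in>S. w x)"
  using assms
proof (induction "card S" arbitrary: S rule: less_induct)
  case less
  note r_in = less.prems(3) and r_per = less.prems(4) and r_free = less.prems(5) and w_inv = less.prems(6)
  show ?case
  proof (cases "S = {}")
    case False
    then obtain x where x: "x \<in> S" by blast
    have pow_in: "(r ^^ i) x \<in> S" for i
      by (induction i) (use x r_in in auto)
    have pow_w: "w ((r ^^ i) x) = w x" for i
      by (induction i) (use pow_in w_inv in auto)
    define Orb where "Orb = (\<lambda>i. (r ^^ i) x) ` {..<q}"
    have inj: "inj_on (\<lambda>i. (r ^^ i) x) {..<q}"
    proof (rule linorder_inj_onI')
      fix i j assume ij: "i \<in> {..<q}" "j \<in> {..<q}" "i < j"
      have "(r ^^ (j - i)) ((r ^^ i) x) = (r ^^ j) x"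
        using ij funpow_add[of "j - i" i r] by simp
      then show "(r ^^ i) x \<noteq> (r ^^ j) x"
        using r_free[OF pow_in, of "j - i" i] ij less_imp_diff_less[of j q i] by auto
    qed
    have Orb_sub: "Orb \<subseteq> S"
      using pow_in by (auto simp: Orb_def)
    have fin_Orb: "finite Orb" and ne: "Orb \<noteq> {}"
      using less.prems(2) by (auto simp: Orb_def)
    have "(\<Sum>y\<in>Orb. w y) = int q * w x"
      unfolding Orb_def by (subst sum.reindex[OF inj]) (simp add: pow_w)
    moreover have "int q dvd (\<Sum>y\<in>S - Orb. w y)"
    proof (rule less.hyps)
      show "card (S - Orb) < card S"
        using less.prems(1) Orb_sub ne by (intro psubset_card_mono) auto
      fix y assume y: "y \<in> S - Orb"
      \<comment> \<open>The complement of the orbit is stable: on \<open>S\<close> the map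
        \<open>r\<close> is inverted by its power \<open>q - 1\<close>, so a point sent into the
        orbit already lies there.\<close>
      have "y \<in> Orb" if orb: "r y \<in> Orb"
      proof -
        obtain i where i: "r y = (r ^^ i) x"
          using orb by (auto simp: Orb_def)
        have "y = (r ^^ (q - 1)) (r y)"
          using r_per[of y] y less.prems(2) by (cases q) (auto simp: funpow_swap1)
        also have "\<dots> = (r ^^ (q - 1 + i)) x"
          by (simp add: i funpow_add)
        also have "\<dots> = (r ^^ ((q - 1 + i) mod q)) x"
          by (rule funpow_mod_eq[symmetric, OF r_per[OF x]])
        finally show ?thesis
          unfolding Orb_def by (rule image_eqI) (use less.prems(2) in simp)
      qed
      then show "r y \<in> S - Orb"
        using y r_in by auto
    qed (use less.prems in auto)
    ultimately show ?thesis
      using sum.subset_diff[OF Orb_sub less.prems(1), of w] by simp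
  qed simp
qed

section \<open>Products of words in a monoid or group\<close>

lemma (in monoid) foldr_mult_closed [simp]:
  "set ws \<subseteq> carrier G \<Longrightarrow> foldr (\<otimes>) ws \<one> \<in> carrier G"
  by (induction ws) auto

lemma (in monoid) foldr_mult_init:
  "set us \<subseteq> carrier G \<Longrightarrow> g \<in> carrier G \<Longrightarrow> foldr (\<otimes>) us g = foldr (\<otimes>) us \<one> \<otimes> g"
  by (induction us) (auto simp: m_assoc)

lemma (in monoid) foldr_mult_concat_replicate:
  assumes "set us \<subseteq> carrier G"
  shows "foldr (\<otimes>) (concat (replicate n us)) \<one> = foldr (\<otimes>) us \<one> [^] n"
proof (induction n)
  case (Suc n)
  have "set (concat (replicate n us)) \<subseteq> carrier G"
    using assms by (auto split: if_splits)
  then show ?case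
    using assms Suc nat_pow_Suc2[OF foldr_mult_closed[OF assms], of n]
    by (simp add: foldr_mult_init[of us "foldr (\<otimes>) us \<one> [^] n"])
qed simp

text \<open>Rotation by one letter turns a product v u into u v, and in a group u v = 1 forces v u =
  1. The induction undoes the rotations one at a time.\<close>

lemma (in group) foldr_mult_rotate_eq_one:
  assumes "set ws \<subseteq> carrier G" "foldr (\<otimes>) (rotate n ws) \<one> = \<one>"
  shows "foldr (\<otimes>) ws \<one> = \<one>"
  using assms(2)
proof (induction n)
  case (Suc n)
  define vs where "vs = rotate n ws"
  have vs: "set vs \<subseteq> carrier G"
    using assms(1) by (simp add: vs_def)
  have "foldr (\<otimes>) vs \<one> = \<one>"
  proof (cases vs)
    case (Cons v us)
    have "foldr (\<otimes>) us \<one> \<otimes> v = \<one>"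
      using Suc.prems vs foldr_mult_init[of us v] by (simp add: Cons flip: vs_def)
    then have "v \<otimes> foldr (\<otimes>) us \<one> = \<one>"
      by (rule inv_comm) (use vs Cons in auto)
    then show ?thesis by (simp add: Cons)
  qed simp
  then show ?case
    by (intro Suc.IH) (simp add: vs_def)
qed (use assms in simp)

text \<open>Rotation by k / p^v letters generates a cyclic action of order p^v that preserves
  weights. It is free: a word fixed by a nontrivial rotation in it is a repetition whose number of
  blocks is a multiple of p, and its product is then 1.\<close>

lemma prime_power_dvd_sum_words:
  fixes f :: "'a \<Rightarrow> int" and G (structure)
  assumes "group G" and fin: "finite (carrier G)" and p: "prime p"
    and exponent: "\<And>g. g \<in> carrier G \<Longrightarrow> g [^] p = \<one>"
    and k: "p ^ v dvd k" "k > 0"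
  shows "int p ^ v dvd
    (\<Sum>ws | set ws \<subseteq> carrier G \<and> length ws = k \<and> foldr (\<otimes>) ws \<one> \<noteq> \<one>. prod_list (map f ws))"
    (is "_ dvd sum ?w ?S")
proof -
  interpret group G by fact
  define q where "q = p ^ v"
  obtain d where d: "k = q * d"
    using k by (auto simp: q_def)
  with k have d0: "d > 0" and q0: "q > 0" by auto
  have "int q dvd sum ?w ?S"
  proof (rule dvd_sum_of_free_cyclic_action[where r = "rotate d"])
    show "finite ?S"
      by (rule finite_subset[OF _ finite_lists_length_eq[OF fin, of k]]) auto
    fix ws assume ws: "ws \<in> ?S"
    then show "rotate d ws \<in> ?S"
      using foldr_mult_rotate_eq_one[of ws d] by auto
    have pow: "(rotate d ^^ i) xs = rotate (i * d) xs" for i and xs :: "'a list"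
      by (induction i) (simp_all add: rotate_rotate)
    show "(rotate d ^^ q) ws = ws"
      using ws by (simp add: pow d rotate_id)
    have "prod_list (rotate1 xs) = prod_list xs" for xs :: "int list"
      by (cases xs) simp_all
    then have "prod_list (rotate n xs) = prod_list xs" for n and xs :: "int list"
      by (induction n) simp_all
    then have "prod_list (map f (rotate n ws)) = prod_list (map f ws)" for n
      by (simp flip: rotate_map)
    then show "?w (rotate d ws) = ?w ws" .
    fix i assume i: "0 < i" "i < q"
    have id: "0 < i * d" "i * d < k"
      using i d0 by (simp_all add: d)
    show "(rotate d ^^ i) ws \<noteq> ws"
    proof
      assume "(rotate d ^^ i) ws = ws"
      \<comment> \<open>A word fixed by a rotation splits into two commuting pieces, and commuting
        words are powers of a common word \<open>zs\<close>.\<close>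
      then have "drop (i * d) ws @ take (i * d) ws = ws"
        using ws id by (simp add: pow rotate_drop_take)
      then obtain m n zs where mn: "concat (replicate m zs) = take (i * d) ws"
          "concat (replicate n zs) = drop (i * d) ws"
        using comm_append_are_replicate[of "take (i * d) ws" "drop (i * d) ws"] by auto
      then have ws_eq: "ws = concat (replicate (m + n) zs)"
        by (simp add: replicate_add)
      have lens: "m * length zs = i * d" "(m + n) * length zs = q * d"
        using arg_cong[OF mn(1), of length] arg_cong[OF ws_eq, of length] ws id
        by (simp_all add: length_concat sum_list_replicate d)
      \<comment> \<open>Comparing lengths gives i (m + n) = m q. If p did not divide m + n, then q
        would divide i, contradicting 0 < i < q.\<close>
      have "i * (m + n) * d = m * q * d"
        by (metis lens mult.assoc mult.commute)
      then have "q dvd i * (m + n)"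
        using d0 by simp
      have "p dvd m + n"
      proof (rule ccontr)
        assume "\<not> p dvd m + n"
        then have "coprime q (m + n)"
          using p by (simp add: q_def prime_imp_coprime)
        with \<open>q dvd i * (m + n)\<close> have "q dvd i"
          by (simp add: coprime_dvd_mult_left_iff)
        with i show False
          by (auto dest: dvd_imp_le)
      qed
      then obtain j where j: "m + n = p * j" by blast
      have zs: "set zs \<subseteq> carrier G"
      proof -
        have "m + n \<noteq> 0" using lens(2) q0 d0 by (intro notI) simp
        then have "set ws = set zs" unfolding ws_eq by auto
        with ws show ?thesis by simp
      qed
      have "foldr (\<otimes>) ws \<one> = (foldr (\<otimes>) zs \<one> [^] p) [^] j"
        unfolding ws_eq using zs by (simp add: foldr_mult_concat_replicate nat_pow_pow j)
      also have "\<dots> = \<one>"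
        using zs by (simp add: exponent)
      finally show False using ws by simp
    qed
  qed (use q0 in auto)
  then show ?thesis by (simp add: q_def)
qed

section \<open>Integrality of an exponential\<close>

text \<open>For prime \<open>p\<close> this is the localisation of the integers at \<open>p\<close>,
  viewed inside an arbitrary field of characteristic 0, because the power series below have complex
  coefficients.\<close>

definition p_integral :: "nat \<Rightarrow> 'a::field_char_0 \<Rightarrow> bool" where
  "p_integral p x \<longleftrightarrow> (\<exists>m::int. coprime m (int p) \<and> of_int m * x \<in> \<int>)"

lemma p_integral_of_int [simp]: "p_integral p (of_int z)"
  unfolding p_integral_def by (intro exI[of _ 1]) auto

lemma p_integral_0 [simp]: "p_integral p 0"
  using p_integral_of_int[of p 0] by simp

lemma p_integral_1 [simp]: "p_integral p 1"
  using p_integral_of_int[of p 1] by simp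

lemma p_integral_mult:
  assumes "p_integral p x" "p_integral p y"
  shows "p_integral p (x * y)"
proof -
  obtain m n :: int where *: "coprime m (int p)" "coprime n (int p)"
      "of_int m * x \<in> \<int>" "of_int n * y \<in> \<int>"
    using assms by (auto simp: p_integral_def)
  have "of_int (m * n) * (x * y) = (of_int m * x) * (of_int n * y)"
    by simp
  also have "\<dots> \<in> \<int>" using *(3,4) by (rule Ints_mult)
  finally show ?thesis
    unfolding p_integral_def using * by (intro exI[of _ "m * n"]) simp
qed

lemma p_integral_add:
  assumes "p_integral p x" "p_integral p y"
  shows "p_integral p (x + y)"
proof -
  obtain m n :: int where *: "coprime m (int p)" "coprime n (int p)"
      "of_int m * x \<in> \<int>" "of_int n * y \<in> \<int>"
    using assms by (auto simp: p_integral_def)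
  have "of_int (m * n) * (x + y) = of_int n * (of_int m * x) + of_int m * (of_int n * y)"
    by (simp add: algebra_simps)
  also have "\<dots> \<in> \<int>" using *(3,4) by (blast intro: Ints_mult Ints_add Ints_of_int)
  finally show ?thesis
    unfolding p_integral_def using * by (intro exI[of _ "m * n"]) simp
qed

lemma p_integral_sum: "(\<And>i. i \<in> A \<Longrightarrow> p_integral p (f i)) \<Longrightarrow> p_integral p (sum f A)"
  by (induction A rule: infinite_finite_induct) (auto intro: p_integral_add)

text \<open>The full power of p in k cancels against z, and the remaining denominator is prime to
  p.\<close>

lemma p_integral_divide_nat:
  fixes z :: int and k :: nat
  assumes p: "prime p" and "k > 0" and dvd: "\<And>v. p ^ v dvd k \<Longrightarrow> int p ^ v dvd z"
  shows "p_integral p (of_int z / of_nat k :: 'a::field_char_0)"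
proof -
  obtain k' where k': "k = p ^ multiplicity p k * k'" "\<not> p dvd k'"
    using multiplicity_decompose'[of k p] p assms(2)
    by (metis neq0_conv not_prime_unit)
  obtain z' where z': "z = int p ^ multiplicity p k * z'"
    using dvd[OF multiplicity_dvd] by blast
  have "p ^ multiplicity p k \<noteq> 0" "k' \<noteq> 0"
    using p k'(2) by (auto simp: prime_gt_0_nat intro!: Nat.gr0I)
  then have "of_int (int k') * (of_int z / of_nat k :: 'a) = of_int z'"
    by (subst k'(1)) (simp add: z' field_simps)
  moreover have "coprime (int k') (int p)"
    using p k'(2) by (simp add: coprime_commute[of k'] prime_imp_coprime)
  ultimately show ?thesis
    unfolding p_integral_def by (intro exI[of _ "int k'"]) simp
qed

text \<open>Clearing a denominator c prime to p gives c z = p^m b over the integers, and c can be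
  cancelled modulo p^m.\<close>

lemma prime_power_dvd_of_p_integral:
  assumes "p_integral p (x::'a::field_char_0)" "of_int z = of_int (int p ^ m) * x"
  shows "int p ^ m dvd z"
proof -
  obtain c b :: int where c: "coprime c (int p)" "of_int c * x = of_int b"
    using assms(1) by (auto simp: p_integral_def elim: Ints_cases)
  have "(of_int (c * z) :: 'a) = of_int (int p ^ m) * (of_int c * x)"
    by (simp add: assms(2))
  also have "\<dots> = of_int (int p ^ m * b)"
    by (simp only: c of_int_mult)
  finally have "c * z = int p ^ m * b"
    by (simp only: of_int_eq_iff)
  then have "int p ^ m dvd c * z" by simp
  moreover have "coprime (int p ^ m) c"
    using c by (simp add: coprime_commute)
  ultimately show ?thesis
    by (simp add: coprime_dvd_mult_right_iff)
qed

section \<open>The p-adic valuation of factorials\<close>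

lemma multiplicity_fact_add:
  assumes p: "prime p" and "r < p"
  shows "multiplicity p (fact (p * q + r) :: nat) = multiplicity p (fact (p * q) :: nat)"
  using assms(2)
proof (induction r)
  case (Suc r)
  have "\<not> p dvd Suc (p * q + r)"
  proof
    assume "p dvd Suc (p * q + r)"
    then have "p dvd p * q + Suc r" by simp
    then have "p dvd Suc r" by (metis dvd_add_right_iff dvd_triv_left)
    with Suc.prems show False by (auto dest: dvd_imp_le)
  qed
  then have "multiplicity p (Suc (p * q + r)) = 0"
    by (rule not_dvd_imp_multiplicity_0)
  with Suc p show ?case
    by (simp del: mult_Suc mult_Suc_right
      add: prime_elem_multiplicity_mult_distrib)
qed simp

text \<open>Only the q multiples of p among the factors of (p q)! count. Taking one p out of each
  leaves q!.\<close>

lemma multiplicity_fact_times: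
  assumes p: "prime p"
  shows "multiplicity p (fact (p * q) :: nat) = q + multiplicity p (fact q :: nat)"
proof (induction q)
  case (Suc q)
  have "p * Suc q = Suc (p * q + (p - 1))"
    using p by (simp add: prime_gt_0_nat)
  then have "(fact (p * Suc q) :: nat) = (p * Suc q) * fact (p * q + (p - 1))"
    by (metis fact_Suc of_nat_id)
  then have "multiplicity p (fact (p * Suc q) :: nat) =
      1 + multiplicity p (Suc q) + multiplicity p (fact (p * q) :: nat)"
    using p multiplicity_fact_add[OF p, of "p - 1" q]
    by (simp del: mult_Suc mult_Suc_right fact_Suc
      add: prime_elem_multiplicity_mult_distrib prime_gt_0_nat)
  also have "\<dots> = Suc q + multiplicity p (fact (Suc q) :: nat)"
    using p by (simp add: Suc.IH prime_elem_multiplicity_mult_distrib del: mult_Suc)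
  finally show ?case .
qed simp

text \<open>With q = n div p the valuation is q plus that of q!. For q > 0 induction bounds this
  strictly by 2 q, which is at most n.\<close>

lemma multiplicity_fact_less:
  assumes p: "prime p" and "n > 0"
  shows "multiplicity p (fact n :: nat) < n"
  using assms(2)
proof (induction n rule: less_induct)
  case (less n)
  define q where "q = n div p"
  have *: "multiplicity p (fact n :: nat) = q + multiplicity p (fact q :: nat)"
    using p multiplicity_fact_add[OF p, of "n mod p" q] by (simp add: q_def multiplicity_fact_times[OF p] prime_gt_0_nat)
  show ?case
  proof (cases "q = 0")
    case False
    have "2 * q \<le> p * q" using prime_ge_2_nat[OF p] by simp
    also have "\<dots> \<le> n" by (simp add: q_def)
    finally have "2 * q \<le> n" .
    with False less.IH[of q] * show ?thesis by linarith
  qed (use * less.prems in simp)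
qed

text \<open>With N = p^m the quotient is N^(i-1) / i!. It is p-integral because the valuation of i!
  is at most i - 1, hence at most m (i - 1).\<close>

lemma p_integral_exp_coeff:
  assumes p: "prime p" and "m > 0" "i > 0"
  shows "\<exists>x::'a::field_char_0. p_integral p x \<and> of_int (int p ^ m) ^ i / fact i = of_int (int p ^ m) * x"
proof (intro exI[of _ "of_int (int p ^ (m * (i - 1))) / of_nat (fact i)"] conjI)
  show "p_integral p (of_int (int p ^ (m * (i - 1))) / of_nat (fact i) :: 'a)"
  proof (rule p_integral_divide_nat[OF p])
    fix v assume "p ^ v dvd fact i"
    then have "v \<le> multiplicity p (fact i :: nat)"
      using p by (intro multiplicity_geI) (auto simp: not_prime_unit)
    with multiplicity_fact_less[OF p assms(3)] have "v \<le> i - 1" by simp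
    also have "\<dots> \<le> m * (i - 1)" using assms by simp
    finally show "int p ^ v dvd int p ^ (m * (i - 1))"
      by (rule le_imp_power_dvd)
  qed simp
  have "(int p ^ m) ^ i = int p ^ m * int p ^ (m * (i - 1))"
    using assms(3) by (cases i) (simp_all add: power_mult)
  then show "of_int (int p ^ m) ^ i / fact i =
      of_int (int p ^ m) * (of_int (int p ^ (m * (i - 1))) / of_nat (fact i) :: 'a)"
    using assms(3) by (metis of_int_mult of_int_power of_nat_fact times_divide_eq_right)
qed

section \<open>Power series and logarithmic derivatives\<close>

lemma p_integral_fps_power:
  fixes f :: "'a::field_char_0 fps"
  assumes "\<And>k. p_integral p (f $ k)"
  shows "p_integral p ((f ^ i) $ k)"
proof (induction i arbitrary: k)
  case (Suc i)
  then show ?case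
    using assms by (auto simp: fps_mult_nth intro!: p_integral_sum p_integral_mult)
qed simp

text \<open>The equation determines each coefficient from the earlier ones, after a division by k +
  1 that characteristic 0 permits.\<close>

lemma fps_deriv_eq_unique:
  fixes P Q :: "'a::field_char_0 fps"
  assumes "fps_deriv P = P * u" "fps_deriv Q = Q * u" "P $ 0 = Q $ 0"
  shows "P = Q"
proof -
  have "P $ k = Q $ k" for k
  proof (induction k rule: less_induct)
    case (less k)
    show ?case
    proof (cases k)
      case (Suc j)
      have "fps_deriv P $ j = fps_deriv Q $ j"
        unfolding assms fps_mult_nth using less.IH Suc by simp
      then show ?thesis
        by (simp add: Suc del: of_nat_Suc)
    qed (use assms in simp)
  qed
  then show ?thesis by (simp add: fps_eq_iff)
qed

text \<open>
  With \<open>f = \<Sum> d\<^sub>k / k X\<^sup>k\<close> and \<open>N = p\<^sup>m\<close>, the hypotheses say \<open>P / Q = exp (N f)\<close>, and the coefficients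
  \<open>N\<^sup>i / i!\<close> for \<open>i > 0\<close> are divisible by \<open>N\<close> in the localisation at \<open>p\<close>.
\<close>

lemma fps_cong_of_log_deriv:
  fixes P Q :: "'a::field_char_0 fps"
  assumes p: "prime p" and m: "m > 0"
    and P: "fps_deriv P = P * Abs_fps u" and Q: "fps_deriv Q = Q * Abs_fps w"
    and init: "P $ 0 = 1" "Q $ 0 = 1"
    and uw: "\<And>k. u k - w k = of_int (int p ^ m * d (Suc k))"
    and d: "\<And>v k. k > 0 \<Longrightarrow> p ^ v dvd k \<Longrightarrow> int p ^ v dvd d k"
    and int: "P $ k = of_int a" "\<And>j. Q $ j \<in> \<int>" "Q $ k = of_int b"
  shows "[a = b] (mod (int p ^ m))"
proof -
  define N :: 'a where "N = of_int (int p ^ m)"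
  \<comment> \<open>At index 0 the quotient is a division by zero, hence 0; this is the vanishing
    constant term that composition with the exponential requires.\<close>
  define f :: "'a fps" where "f = Abs_fps (\<lambda>k. of_int (d k) / of_nat k)"
  define E where "E = fps_exp N oo f"
  have f0: "f $ 0 = 0" by (simp add: f_def)
  have f_int: "p_integral p (f $ k)" for k
    using p_integral_divide_nat[OF p, of k "d k"] d[of k] by (cases "k = 0") (auto simp: f_def)
  have f_deriv: "fps_const N * fps_deriv f = Abs_fps u - Abs_fps w"
    by (rule fps_ext) (simp add: f_def uw N_def del: of_nat_Suc)
  have "fps_deriv E = E * (Abs_fps u - Abs_fps w)"
    by (simp add: E_def fps_compose_deriv[OF f0] f_deriv[symmetric] fps_const_mult_apply_left[symmetric])
  then have "fps_deriv (Q * E) = Q * (E * (Abs_fps u - Abs_fps w)) + Q * Abs_fps w * E"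
    by (simp add: Q)
  also have "\<dots> = (Q * E) * Abs_fps u"
    by (simp add: algebra_simps)
  finally have "fps_deriv (Q * E) = (Q * E) * Abs_fps u" .
  \<comment> \<open>\<open>P\<close> and \<open>Q * E\<close> solve the same first-order linear
    equation and both have constant term 1.\<close>
  then have PQE: "P = Q * E"
    by (rule fps_deriv_eq_unique[OF P]) (simp add: init E_def)
  \<comment> \<open>The term i = 0 of the exponential gives the constant 1; all later terms carry a
    factor \<open>N\<close> with a p-integral cofactor.\<close>
  have E_nth: "\<exists>x. p_integral p x \<and> E $ j = of_bool (j = 0) + N * x" for j
  proof -
    define g where "g i = (SOME x::'a. p_integral p x \<and> N ^ i / fact i = N * x)" for i
    have g: "p_integral p (g i)" "N ^ i / fact i = N * g i" if "i > 0" for i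
      using someI_ex[OF p_integral_exp_coeff[OF p m that, where ?'a = 'a]]
      by (auto simp: g_def N_def)
    have "E $ j = (\<Sum>i=0..j. N ^ i / fact i * (f ^ i) $ j)"
      by (simp add: E_def fps_compose_nth fps_exp_def)
    also have "\<dots> = of_bool (j = 0) + (\<Sum>i=1..j. N ^ i / fact i * (f ^ i) $ j)"
      by (subst sum.atLeast_Suc_atMost) auto
    also have "(\<Sum>i=1..j. N ^ i / fact i * (f ^ i) $ j) = N * (\<Sum>i=1..j. g i * (f ^ i) $ j)"
      unfolding sum_distrib_left by (intro sum.cong refl) (simp add: g(2))
    finally show ?thesis
      by (intro exI[of _ "\<Sum>i=1..j. g i * (f ^ i) $ j"] conjI p_integral_sum p_integral_mult
          p_integral_fps_power f_int) (auto intro: g)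
  qed
  then obtain x where x: "\<And>j. p_integral p (x j)" "\<And>j. E $ j = of_bool (j = 0) + N * x j"
    by metis
  have "P $ k = (\<Sum>j=0..k. Q $ j * of_bool (k - j = 0)) + N * (\<Sum>j=0..k. Q $ j * x (k - j))"
    by (simp add: PQE fps_mult_nth x sum.distrib distrib_left mult.left_commute[of _ N] flip: sum_distrib_left)
  also have "(\<Sum>j=0..k. Q $ j * of_bool (k - j = 0)) = (\<Sum>j=0..k. if j = k then Q $ j else 0)"
    by (intro sum.cong) auto
  also have "\<dots> = Q $ k"
    by simp
  finally have "of_int (a - b) = of_int (int p ^ m) * (\<Sum>j=0..k. Q $ j * x (k - j))"
    using int by (simp add: N_def)
  moreover have "p_integral p (Q $ j)" for j
    using int(2)[of j] by (auto elim: Ints_cases)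
  then have "p_integral p (\<Sum>j=0..k. Q $ j * x (k - j))"
    by (intro p_integral_sum p_integral_mult x)
  ultimately have "int p ^ m dvd a - b"
    using prime_power_dvd_of_p_integral by blast
  then show ?thesis
    by (simp add: cong_iff_dvd_diff)
qed

section \<open>Traces of powers and the reversed characteristic polynomial\<close>

definition mat_trace :: "'a::semiring_0 mat \<Rightarrow> 'a" where
  "mat_trace A = (\<Sum>i<dim_row A. A $$ (i, i))"

lemma mat_trace_mult_commute:
  fixes A B :: "'a::comm_semiring_0 mat"
  assumes "A \<in> carrier_mat n n" "B \<in> carrier_mat n n"
  shows "mat_trace (A * B) = mat_trace (B * A)"
proof -
  have "mat_trace (A * B) = (\<Sum>i<n. \<Sum>j<n. A $$ (i, j) * B $$ (j, i))"
    using assms by (simp add: mat_trace_def scalar_prod_def atLeast0LessThan)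
  also have "\<dots> = (\<Sum>j<n. \<Sum>i<n. B $$ (j, i) * A $$ (i, j))"
    by (subst sum.swap) (simp add: mult.commute)
  also have "\<dots> = mat_trace (B * A)"
    using assms by (simp add: mat_trace_def scalar_prod_def atLeast0LessThan)
  finally show ?thesis .
qed

text \<open>A summand \<open>A $$ (i, k) * B $$ (k, j)\<close> can be nonzero only for i \<le> k
  \<le> j. This leaves nothing below the diagonal and only k = i on it.\<close>

lemma upper_triangular_mult:
  fixes A B :: "'a::semiring_0 mat"
  assumes "A \<in> carrier_mat n n" "B \<in> carrier_mat n n" "upper_triangular A" "upper_triangular B"
  shows "upper_triangular (A * B)"
    and "i < n \<Longrightarrow> (A * B) $$ (i, i) = A $$ (i, i) * B $$ (i, i)"
proof -
  have *: "A $$ (i, k) * B $$ (k, j) = 0" if "i < n" "k < n" "j < i \<or> (j = i \<and> k \<noteq> i)" for i j k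
    using that assms upper_triangularD[OF assms(3), of k i] upper_triangularD[OF assms(4), of j k]
    by (cases "k < i") auto
  show "upper_triangular (A * B)"
  proof (rule upper_triangularI)
    fix i j assume "j < i" "i < dim_row (A * B)"
    then show "(A * B) $$ (i, j) = 0"
      using assms * by (auto simp: scalar_prod_def intro!: sum.neutral)
  qed
  assume i: "i < n"
  have "(A * B) $$ (i, i) = (\<Sum>k<n. A $$ (i, k) * B $$ (k, i))"
    using assms i by (simp add: scalar_prod_def atLeast0LessThan)
  also have "\<dots> = (\<Sum>k<n. if k = i then A $$ (i, i) * B $$ (i, i) else 0)"
    using i * by (intro sum.cong) auto
  finally show "(A * B) $$ (i, i) = A $$ (i, i) * B $$ (i, i)"
    using i by simp
qed

lemma upper_triangular_pow:
  fixes A :: "'a::semiring_1 mat"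
  assumes "A \<in> carrier_mat n n" "upper_triangular A"
  shows "upper_triangular (A ^\<^sub>m k) \<and> (\<forall>i<n. (A ^\<^sub>m k) $$ (i, i) = (A $$ (i, i)) ^ k)"
proof (induction k)
  case 0
  show ?case using assms by (auto simp: upper_triangular_def)
next
  case (Suc k)
  have "A ^\<^sub>m k \<in> carrier_mat n n"
    using assms by simp
  with Suc assms upper_triangular_mult[of "A ^\<^sub>m k" n A] show ?case
    by (simp add: power_commutes)
qed

text \<open>A Schur decomposition reduces the claim to a triangular matrix with diagonal
  \<open>es\<close>; the trace is unchanged because it is invariant under swapping two
  factors.\<close>

lemma mat_trace_pow_eq_sum_eigenvalues:
  fixes A :: "complex mat"
  assumes A: "A \<in> carrier_mat n n" and es: "char_poly A = (\<Prod>e\<leftarrow>es. [:- e, 1:])"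
  shows "mat_trace (A ^\<^sub>m k) = (\<Sum>e\<leftarrow>es. e ^ k)"
proof -
  obtain B P Q where "schur_decomposition A es = (B, P, Q)"
    by (cases "schur_decomposition A es")
  from schur_decomposition[OF A es this]
  have sim: "similar_mat_wit A B P Q" and tri: "upper_triangular B" and diag: "diag_mat B = es"
    by auto
  have carr: "B \<in> carrier_mat n n" "P \<in> carrier_mat n n" "Q \<in> carrier_mat n n" "Q * P = 1\<^sub>m n"
    using similar_mat_witD2[OF A sim] by auto
  have Bk: "B ^\<^sub>m k \<in> carrier_mat n n"
    using carr by simp
  have "mat_trace (A ^\<^sub>m k) = mat_trace (P * (B ^\<^sub>m k * Q))"
    using carr Bk by (simp add: similar_mat_wit_pow_id[OF sim] assoc_mult_mat[of _ n n _ n _ n])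
  also have "\<dots> = mat_trace (B ^\<^sub>m k * Q * P)"
    using carr Bk by (intro mat_trace_mult_commute[of _ n]) auto
  also have "B ^\<^sub>m k * Q * P = B ^\<^sub>m k"
    using carr Bk by (simp add: assoc_mult_mat[of _ n n _ n _ n])
  also have "mat_trace (B ^\<^sub>m k) = (\<Sum>i<n. (B $$ (i, i)) ^ k)"
    using upper_triangular_pow[OF carr(1) tri, of k] carr(1) by (simp add: mat_trace_def)
  also have "\<dots> = (\<Sum>e\<leftarrow>es. e ^ k)"
    using carr(1) by (simp add: diag[symmetric] diag_mat_def sum_list_distinct_conv_sum_set o_def
        atLeast0LessThan)
  finally show ?thesis .
qed

text \<open>Evaluation at 0 is a ring homomorphism, so it commutes with the determinant and turns X
  - A into -A.\<close>

lemma coeff_0_char_poly: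
  fixes A :: "'a::comm_ring_1 mat"
  assumes A: "A \<in> carrier_mat n n"
  shows "coeff (char_poly A) 0 = (-1) ^ n * det A"
proof -
  have hom: "comm_ring_hom (\<lambda>q::'a poly. poly q 0)"
    by unfold_locales simp_all
  have "coeff (char_poly A) 0 = det (map_mat (\<lambda>q. poly q 0) (char_poly_matrix A))"
    by (simp add: char_poly_def poly_0_coeff_0[symmetric] comm_ring_hom.hom_det[OF hom])
  also have "map_mat (\<lambda>q. poly q 0) (char_poly_matrix A) = (-1) \<cdot>\<^sub>m A"
    using A by (intro eq_matI) (auto simp: char_poly_matrix_def)
  finally show ?thesis
    using A by (simp add: det_smult)
qed

text \<open>Newton's identities in logarithmic form: each factor 1 - e X has logarithmic derivative
  -e / (1 - e X), and these add up to the negated power sums.\<close>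

lemma fps_deriv_prod_list_linear:
  fixes es :: "'a::field_char_0 list"
  shows "fps_deriv (\<Prod>e\<leftarrow>es. 1 - fps_const e * fps_X) =
    (\<Prod>e\<leftarrow>es. 1 - fps_const e * fps_X) * Abs_fps (\<lambda>k. - (\<Sum>e\<leftarrow>es. e ^ Suc k))"
proof (induction es)
  case Nil
  have "Abs_fps (\<lambda>k. - (\<Sum>e\<leftarrow>[]. e ^ Suc k)) = (0 :: 'a fps)"
    by (rule fps_ext) simp
  then show ?case by simp
next
  case (Cons e es)
  define P where "P = (\<Prod>e\<leftarrow>es. 1 - fps_const e * fps_X)"
  define u where "u = Abs_fps (\<lambda>k. - (\<Sum>e\<leftarrow>es. e ^ Suc k))"
  \<comment> \<open>This is the geometric series of -e / (1 - e X).\<close>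
  define v where "v = Abs_fps (\<lambda>k. - (e ^ Suc k))"
  have v: "(1 - fps_const e * fps_X) * v = - fps_const e"
    by (rule fps_ext) (simp add: v_def left_diff_distrib mult.assoc power_eq_if)
  have "Abs_fps (\<lambda>k. - (\<Sum>e\<leftarrow>e # es. e ^ Suc k)) = v + u"
    by (rule fps_ext) (simp add: u_def v_def)
  moreover have "fps_deriv ((1 - fps_const e * fps_X) * P) = (1 - fps_const e * fps_X) * (P * u) - fps_const e * P"
    using Cons.IH by (simp only: P_def[symmetric] u_def[symmetric]) (simp flip: fps_const_neg)
  moreover have "(1 - fps_const e * fps_X) * P * (v + u)
      = (1 - fps_const e * fps_X) * (P * u) + ((1 - fps_const e * fps_X) * v) * P"
    by (simp only: algebra_simps)
  ultimately show ?case
    by (simp add: P_def[symmetric] v del: fps_const_neg)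
qed

text \<open>Reversal is multiplicative and sends X - e to 1 - e X. When \<open>es\<close> lists the
  eigenvalues of A, the result is det (1 - A X).\<close>

lemma fps_of_reflect_poly_linear_factors:
  fixes es :: "'a::field_char_0 list"
  shows "fps_of_poly (reflect_poly (\<Prod>e\<leftarrow>es. [:- e, 1:])) = (\<Prod>e\<leftarrow>es. 1 - fps_const e * fps_X)"
proof -
  have "fps_of_poly (reflect_poly [:- e, 1:]) = 1 - fps_const e * fps_X" for e :: 'a
    by (rule fps_ext) (auto simp: coeff_reflect_poly coeff_pCons split: nat.split)
  then show ?thesis
    unfolding reflect_poly_prod_list fps_of_poly_prod_list map_map o_def by (simp only:)
qed

section \<open>Group matrices\<close>

lemma sum_lists_length_Suc:
  "(\<Sum>ws | set ws \<subseteq> A \<and> length ws = Suc k. F ws) =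
   (\<Sum>h\<in>A. \<Sum>us | set us \<subseteq> A \<and> length us = k. F (h # us))"
proof -
  have "(\<Sum>ws | set ws \<subseteq> A \<and> length ws = Suc k. F ws) =
      (\<Sum>(us, h)\<in>{us. set us \<subseteq> A \<and> length us = k} \<times> A. F (h # us))"
    unfolding lists_length_Suc_eq
    by (subst sum.reindex) (auto simp: inj_on_def case_prod_unfold intro!: sum.cong)
  also have "\<dots> = (\<Sum>us | set us \<subseteq> A \<and> length us = k. \<Sum>h\<in>A. F (h # us))"
    by (simp add: sum.cartesian_product)
  finally show ?thesis
    by (simp add: sum.swap[of _ A])
qed

lemma sum_prod_list_lists_length:
  fixes f :: "'a \<Rightarrow> 'b::comm_semiring_1"
  shows "(\<Sum>ws | set ws \<subseteq> A \<and> length ws = k. prod_list (map f ws)) = (\<Sum>h\<in>A. f h) ^ k"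
proof (induction k)
  case 0
  have "{ws. set ws \<subseteq> A \<and> length ws = 0} = {[]}" by auto
  then show ?case by simp
next
  case (Suc k)
  then show ?case
    by (simp only: sum_lists_length_Suc list.map prod_list.Cons power_Suc flip: sum_distrib_left)
      (simp add: sum_distrib_right)
qed

text \<open>The recursion defining \<open>^\<^sub>m\<close> multiplies on the right, whereas words
  grow by a new first letter.\<close>

lemma pow_mat_Suc_left:
  fixes A :: "'a::semiring_1 mat"
  assumes "A \<in> carrier_mat n n"
  shows "A ^\<^sub>m Suc k = A * A ^\<^sub>m k"
proof (induction k)
  case (Suc k)
  have "A ^\<^sub>m Suc (Suc k) = (A * A ^\<^sub>m k) * A"
    using Suc by simp
  also have "\<dots> = A * A ^\<^sub>m Suc k"
    using assms by (simp add: assoc_mult_mat[of _ n n _ n _ n])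
  finally show ?case .
qed (use assms in simp)

text \<open>The matrix inside \<open>group_det\<close>, named so that its powers and their traces
  can be studied.\<close>

definition group_matrix :: "('g, 'm) monoid_scheme \<Rightarrow> 'g list \<Rightarrow> ('g \<Rightarrow> 'a) \<Rightarrow> 'a mat" where
  "group_matrix G gs f =
     mat (length gs) (length gs) (\<lambda>(i, j). f (gs ! i \<otimes>\<^bsub>G\<^esub> inv\<^bsub>G\<^esub> (gs ! j)))"

text \<open>Multiplying group matrices is convolution of functions on the group, so the k-th power
  collects the weights of words by their product. The induction peels off the first letter.\<close>

lemma group_matrix_pow_index:
  fixes f :: "'g \<Rightarrow> 'a::comm_semiring_1" and G (structure)
  assumes "group G" and gs: "distinct gs" "set gs = carrier G"
    and "i < length gs" "j < length gs"
  shows "(group_matrix G gs f ^\<^sub>m k) $$ (i, j) =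
    (\<Sum>ws | set ws \<subseteq> carrier G \<and> length ws = k.
       if foldr (\<otimes>) ws \<one> = gs ! i \<otimes> inv (gs ! j) then prod_list (map f ws) else 0)"
  using assms(4,5)
proof (induction k arbitrary: i j)
  interpret group G by fact
  define n where "n = length gs"
  let ?A = "group_matrix G gs f"
  have A: "?A \<in> carrier_mat n n"
    by (simp add: group_matrix_def n_def)
  have gs_in: "gs ! i \<in> carrier G" if "i < n" for i
    using that nth_mem[of i gs] unfolding gs(2) n_def by blast
  {
    case 0
    have words: "{ws. set ws \<subseteq> carrier G \<and> length ws = 0} = {[]}" by auto
    have "\<one> = gs ! i \<otimes> inv (gs ! j) \<longleftrightarrow> i = j"
    proof -
      have ij: "gs ! i \<in> carrier G" "gs ! j \<in> carrier G"
        using 0 gs_in by (simp_all add: n_def)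
      then have "gs ! i \<otimes> inv (gs ! j) = \<one> \<longleftrightarrow> gs ! i = gs ! j"
        using inv_equality[of "gs ! i" "inv (gs ! j)"] by auto
      then show ?thesis
        using 0 gs(1) by (auto simp: nth_eq_iff_index_eq)
    qed
    then show ?case
      unfolding words using 0 A by (simp add: n_def)
  next
    case (Suc k)
    define c where "c g = (\<Sum>ws | set ws \<subseteq> carrier G \<and> length ws = k.
        if foldr (\<otimes>) ws \<one> = g then prod_list (map f ws) else 0)" for g
    have cancel: "x \<otimes> (inv x \<otimes> y) = y" "inv x \<otimes> (x \<otimes> y) = y"
      if "x \<in> carrier G" "y \<in> carrier G" for x y
      using that by (simp_all flip: m_assoc)
    have "(?A ^\<^sub>m Suc k) $$ (i, j) = (?A * ?A ^\<^sub>m k) $$ (i, j)"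
      by (simp only: pow_mat_Suc_left[OF A])
    also have "\<dots> = (\<Sum>l<n. ?A $$ (i, l) * (?A ^\<^sub>m k) $$ (l, j))"
      using A Suc.prems by (simp add: scalar_prod_def atLeast0LessThan n_def)
    also have "\<dots> = (\<Sum>l<n. f (gs ! i \<otimes> inv (gs ! l)) * c (gs ! l \<otimes> inv (gs ! j)))"
      using Suc by (intro sum.cong) (auto simp: c_def n_def group_matrix_def)
    also have "\<dots> = (\<Sum>x\<in>carrier G. f (gs ! i \<otimes> inv x) * c (x \<otimes> inv (gs ! j)))"
      using bij_betw_nth[OF gs(1) refl refl] gs(2)
      by (intro sum.reindex_bij_betw) (simp add: n_def)
    \<comment> \<open>The substitution is h = g x^-1, where g is \<open>gs ! i\<close>; h becomes
      the first letter of the word.\<close>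
    also have "\<dots> = (\<Sum>h\<in>carrier G. f h * c (inv h \<otimes> (gs ! i \<otimes> inv (gs ! j))))"
      using Suc.prems gs_in
      by (intro sum.reindex_bij_witness[of _ "\<lambda>h. inv h \<otimes> gs ! i" "\<lambda>x. gs ! i \<otimes> inv x"])
        (auto simp: n_def inv_mult_group m_assoc cancel)
    also have "\<dots> = (\<Sum>h\<in>carrier G. \<Sum>us | set us \<subseteq> carrier G \<and> length us = k.
        if foldr (\<otimes>) (h # us) \<one> = gs ! i \<otimes> inv (gs ! j) then prod_list (map f (h # us)) else 0)"
    proof (intro sum.cong refl)
      fix h assume h: "h \<in> carrier G"
      have "gs ! i \<otimes> inv (gs ! j) \<in> carrier G"
        using Suc.prems gs_in by (simp add: n_def)
      then have "foldr (\<otimes>) us \<one> = inv h \<otimes> (gs ! i \<otimes> inv (gs ! j)) \<longleftrightarrow>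
          h \<otimes> foldr (\<otimes>) us \<one> = gs ! i \<otimes> inv (gs ! j)" if "set us \<subseteq> carrier G" for us
        using h inv_solve_left[OF foldr_mult_closed[OF that], of h "gs ! i \<otimes> inv (gs ! j)"] by metis
      then show "f h * c (inv h \<otimes> (gs ! i \<otimes> inv (gs ! j))) =
          (\<Sum>us | set us \<subseteq> carrier G \<and> length us = k.
            if foldr (\<otimes>) (h # us) \<one> = gs ! i \<otimes> inv (gs ! j) then prod_list (map f (h # us)) else 0)"
        unfolding c_def sum_distrib_left by (intro sum.cong) auto
    qed
    finally show ?case
      by (simp only: sum_lists_length_Suc)
  }
qed

text \<open>Each diagonal entry is the weight of the words with product 1, that is, the weight of
  all words minus that of the words with nontrivial product.\<close>

lemma mat_trace_group_matrix_pow: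
  fixes f :: "'g \<Rightarrow> 'a::comm_ring_1" and G (structure)
  assumes G: "group G" and gs: "distinct gs" "set gs = carrier G"
  shows "mat_trace (group_matrix G gs f ^\<^sub>m k) = of_nat (length gs) *
    ((\<Sum>g\<in>carrier G. f g) ^ k -
     (\<Sum>ws | set ws \<subseteq> carrier G \<and> length ws = k \<and> foldr (\<otimes>) ws \<one> \<noteq> \<one>. prod_list (map f ws)))"
proof -
  interpret group G by fact
  have fin: "finite {ws. set ws \<subseteq> carrier G \<and> length ws = k}"
    using finite_lists_length_eq[of "carrier G" k] gs(2) by (metis List.finite_set)
  have gs_in: "gs ! i \<in> carrier G" if "i < length gs" for i
    using that nth_mem[of i gs] unfolding gs(2) by blast
  have "mat_trace (group_matrix G gs f ^\<^sub>m k) =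
      (\<Sum>i<length gs. (group_matrix G gs f ^\<^sub>m k) $$ (i, i))"
    by (simp add: mat_trace_def group_matrix_def)
  also have "\<dots> = (\<Sum>i<length gs. \<Sum>ws | set ws \<subseteq> carrier G \<and> length ws = k.
        if foldr (\<otimes>) ws \<one> = \<one> then prod_list (map f ws) else 0)"
    using gs_in by (intro sum.cong refl) (simp only: group_matrix_pow_index[OF G gs] lessThan_iff r_inv)
  also have "\<dots> = of_nat (length gs) * (\<Sum>ws | set ws \<subseteq> carrier G \<and> length ws = k.
        if foldr (\<otimes>) ws \<one> = \<one> then prod_list (map f ws) else 0)"
    by simp
  also have "(\<Sum>ws | set ws \<subseteq> carrier G \<and> length ws = k.
        if foldr (\<otimes>) ws \<one> = \<one> then prod_list (map f ws) else 0) =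
      (\<Sum>ws | set ws \<subseteq> carrier G \<and> length ws = k. prod_list (map f ws)) -
      (\<Sum>ws | set ws \<subseteq> carrier G \<and> length ws = k.
        if foldr (\<otimes>) ws \<one> \<noteq> \<one> then prod_list (map f ws) else 0)"
    unfolding sum_subtractf[symmetric] by (intro sum.cong) auto
  also have "(\<Sum>ws | set ws \<subseteq> carrier G \<and> length ws = k.
        if foldr (\<otimes>) ws \<one> \<noteq> \<one> then prod_list (map f ws) else 0) =
      (\<Sum>ws | set ws \<subseteq> carrier G \<and> length ws = k \<and> foldr (\<otimes>) ws \<one> \<noteq> \<one>. prod_list (map f ws))"
    using fin by (subst sum.inter_filter[symmetric]) (auto intro!: sum.cong)
  finally show ?thesis
    by (simp add: sum_prod_list_lists_length)
qed

section \<open>The congruence for groups of order p^m and exponent p\<close>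

lemma group_det_cong_power:
  fixes f :: "'g \<Rightarrow> int" and G (structure)
  assumes G: "group G" and gs: "distinct gs" "set gs = carrier G"
    and p: "prime p" and m: "m > 0" and order: "card (carrier G) = p ^ m"
    and exponent: "\<And>g. g \<in> carrier G \<Longrightarrow> g [^] p = \<one>"
  shows "[group_det G gs f = (\<Sum>g\<in>carrier G. f g) ^ (p ^ m)] (mod (int p ^ m))"
proof -
  define n where "n = p ^ m"
  define s where "s = (\<Sum>g\<in>carrier G. f g)"
  define d where "d k =
    (\<Sum>ws | set ws \<subseteq> carrier G \<and> length ws = k \<and> foldr (\<otimes>) ws \<one> \<noteq> \<one>. prod_list (map f ws))" for k
  define A where "A = group_matrix G gs f"
  \<comment> \<open>Over the complex numbers the characteristic polynomial splits, so traces of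
    powers become power sums of \<open>es\<close>.\<close>
  define A' where "A' = map_mat (of_int :: int \<Rightarrow> complex) A"
  have len: "length gs = n"
    using gs order distinct_card[of gs] by (simp add: n_def)
  have A: "A \<in> carrier_mat n n" and A': "A' \<in> carrier_mat n n"
    by (simp_all add: A_def A'_def group_matrix_def len)
  have fin: "finite (carrier G)"
    unfolding gs(2)[symmetric] by simp
  obtain es where es: "char_poly A' = (\<Prod>e\<leftarrow>es. [:- e, 1:])" "length es = n"
    using char_poly_factorized[OF A'] by blast
  have trace: "(\<Sum>e\<leftarrow>es. e ^ k) = of_int (int n * (s ^ k - d k))" for k
  proof -
    have "(\<Sum>e\<leftarrow>es. e ^ k) = mat_trace (A' ^\<^sub>m k)"
      using mat_trace_pow_eq_sum_eigenvalues[OF A' es(1)] by simp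
    also have "A' ^\<^sub>m k = map_mat of_int (A ^\<^sub>m k)"
      by (simp add: A'_def of_int_hom.mat_hom_pow[OF A])
    also have "mat_trace \<dots> = of_int (mat_trace (A ^\<^sub>m k))"
      using A by (simp add: mat_trace_def)
    finally show ?thesis
      by (simp add: A_def mat_trace_group_matrix_pow[OF G gs] len s_def d_def)
  qed
  \<comment> \<open>(X - s)^n over the integers; its reversal is \<open>Q\<close>, which therefore
    has integer coefficients.\<close>
  define R where "R = [:- s, 1:] ^ n"
  have R: "map_poly of_int R = (\<Prod>e\<leftarrow>replicate n (of_int s :: complex). [:- e, 1:])"
    by (simp add: R_def of_int_poly_hom.hom_power)
  have degR: "degree R = n"
    by (simp add: R_def degree_linear_power)
  define P where "P = (\<Prod>e\<leftarrow>es. 1 - fps_const e * fps_X)"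
  define Q where "Q = (\<Prod>e\<leftarrow>replicate n (of_int s :: complex). 1 - fps_const e * fps_X)"
  have Q_nth: "Q $ j = (if j > n then 0 else of_int (coeff R (n - j)))" for j
    unfolding Q_def fps_of_reflect_poly_linear_factors[symmetric] R[symmetric]
    by (simp add: coeff_reflect_poly degR)
  have "[(-1) ^ n * det A = (- s) ^ n] (mod (int p ^ m))"
  proof (rule fps_cong_of_log_deriv[OF p m, where P = P and Q = Q and k = n and d = d])
    show "fps_deriv P = P * Abs_fps (\<lambda>k. - (\<Sum>e\<leftarrow>es. e ^ Suc k))"
      unfolding P_def by (rule fps_deriv_prod_list_linear)
    show "fps_deriv Q = Q * Abs_fps (\<lambda>k. - (\<Sum>e\<leftarrow>replicate n (of_int s). e ^ Suc k))"
      unfolding Q_def by (rule fps_deriv_prod_list_linear)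
    have "(\<Prod>e\<leftarrow>xs. 1 - fps_const e * fps_X) $ 0 = 1" for xs :: "complex list"
      by (induction xs) simp_all
    then show "P $ 0 = 1" "Q $ 0 = 1"
      by (simp_all only: P_def Q_def)
    \<comment> \<open>By the trace formula the terms n s^(k+1) cancel, leaving n times
      \<open>d (Suc k)\<close>.\<close>
    show "- (\<Sum>e\<leftarrow>es. e ^ Suc k) - - (\<Sum>e\<leftarrow>replicate n (of_int s :: complex). e ^ Suc k)
        = of_int (int p ^ m * d (Suc k))" for k
      by (simp only: trace) (simp add: sum_list_replicate n_def algebra_simps)
    show "int p ^ v dvd d k" if "k > 0" "p ^ v dvd k" for v k
      unfolding d_def using that fin exponent
      by (intro prime_power_dvd_sum_words[OF G _ p]) auto
    show "Q $ j \<in> \<int>" for j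
      by (simp add: Q_nth)
    show "Q $ n = of_int ((- s) ^ n)"
      by (simp add: Q_nth R_def coeff_0_power)
    have "P $ n = coeff (char_poly A') 0"
      unfolding P_def fps_of_reflect_poly_linear_factors[symmetric] es(1)[symmetric]
      using degree_monic_char_poly[OF A'] by (simp add: coeff_reflect_poly)
    also have "\<dots> = of_int ((-1) ^ n * det A)"
      using coeff_0_char_poly[OF A'] by (simp add: A'_def)
    finally show "P $ n = of_int ((-1) ^ n * det A)" .
  qed
  \<comment> \<open>A second factor (-1)^n removes the signs from both sides, whatever the parity of
    n.\<close>
  then have "[(-1) ^ n * ((-1) ^ n * det A) = (-1) ^ n * (- s) ^ n] (mod (int p ^ m))"
    by (rule cong_scalar_left)
  then show ?thesis
    by (simp add: group_det_def A_def group_matrix_def s_def n_def flip: mult.assoc power_mult_distrib)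
qed

section \<open>The Heisenberg group\<close>

text \<open>The corner entry gains one product a b for each pair of factors, hence the binomial
  coefficient.\<close>

lemma unitri_power:
  assumes "p > 1"
  shows "unitri a b c [^]\<^bsub>heisenberg p\<^esub> n =
    unitri (int n * a mod int p) (int n * b mod int p)
      ((int n * c + int (n choose 2) * (a * b)) mod int p)"
proof (induction n)
  case 0
  show ?case by (simp add: unitri_one numeral_2_eq_2)
next
  case (Suc n)
  have *: "(int n * t mod int p + t) mod int p = int (Suc n) * t mod int p" for t
    unfolding mod_add_left_eq by (simp add: distrib_right add.commute)
  have "((int n * c + int (n choose 2) * (a * b)) mod int p + c + int n * a mod int p * b) mod int p =
      (int n * c + int (n choose 2) * (a * b) + c + int n * a * b) mod int p"
    by (intro mod_add_cong mod_mult_cong) simp_all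
  also have "\<dots> = (int (Suc n) * c + int (Suc n choose 2) * (a * b)) mod int p"
    by (rule arg_cong[of _ _ "\<lambda>t. t mod int p"]) (simp add: numeral_2_eq_2 distrib_right mult.assoc)
  finally show ?case
    unfolding nat_pow_Suc Suc.IH unitri_mult[OF assms] * by simp
qed

text \<open>For odd p the number \<open>p choose 2\<close> is a multiple of p, so all three entries
  above the diagonal vanish modulo p.\<close>

lemma heisenberg_power_eq_one:
  assumes "odd p" "p > 1" "g \<in> carrier (heisenberg p)"
  shows "g [^]\<^bsub>heisenberg p\<^esub> p = \<one>\<^bsub>heisenberg p\<^esub>"
proof -
  obtain a b c where g: "g = unitri a b c"
    using assms by (auto simp: carrier_heisenberg)
  have "even (p - 1)"
    using assms by simp
  then have "p choose 2 = p * ((p - 1) div 2)"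
    by (simp add: choose_two div_mult_swap)
  then show ?thesis
    using assms(2) by (simp add: g unitri_power unitri_one mult.assoc flip: distrib_left)
qed

text \<open>This is the augmentation F(1,1,1): after exchanging the sums, each coefficient is
  counted at exactly one group element.\<close>

lemma sum_group_ring_elem:
  assumes "group G" "finite (carrier G)" "x \<in> carrier G" "y \<in> carrier G" "z \<in> carrier G"
  shows "(\<Sum>g\<in>carrier G. group_ring_elem G p x y z a g) = (\<Sum>i<p. \<Sum>j<p. \<Sum>k<p. a i j k)"
proof -
  interpret group G by fact
  have "(\<Sum>g\<in>carrier G. group_ring_elem G p x y z a g) = (\<Sum>i<p. \<Sum>j<p. \<Sum>k<p. \<Sum>g\<in>carrier G.
      if x [^]\<^bsub>G\<^esub> i \<otimes>\<^bsub>G\<^esub> y [^]\<^bsub>G\<^esub> j \<otimes>\<^bsub>G\<^esub> z [^]\<^bsub>G\<^esub> k = g then a i j k else 0)"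
    unfolding group_ring_elem_def by (simp only: sum.swap[of _ _ "carrier G"])
  then show ?thesis
    using assms by simp
qed

theorem theorem2:
  fixes p :: nat
    and x y z :: "int mat"
    and a :: "nat \<Rightarrow> nat \<Rightarrow> nat \<Rightarrow> int"
    and gs :: "int mat list"
  defines "H \<equiv> heisenberg p"
  assumes "prime p" and "p \<ge> 3"
    and "x \<in> carrier H" and "y \<in> carrier H" and "z \<in> carrier H"
    and "x [^]\<^bsub>H\<^esub> p = \<one>\<^bsub>H\<^esub>" and "y [^]\<^bsub>H\<^esub> p = \<one>\<^bsub>H\<^esub>" and "z [^]\<^bsub>H\<^esub> p = \<one>\<^bsub>H\<^esub>"
    and "x \<otimes>\<^bsub>H\<^esub> z = z \<otimes>\<^bsub>H\<^esub> x" and "y \<otimes>\<^bsub>H\<^esub> z = z \<otimes>\<^bsub>H\<^esub> y"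
    and "y \<otimes>\<^bsub>H\<^esub> x = x \<otimes>\<^bsub>H\<^esub> y \<otimes>\<^bsub>H\<^esub> z"
    and "carrier H =
           {x [^]\<^bsub>H\<^esub> i \<otimes>\<^bsub>H\<^esub> y [^]\<^bsub>H\<^esub> j \<otimes>\<^bsub>H\<^esub> z [^]\<^bsub>H\<^esub> k | i j k. i < p \<and> j < p \<and> k < p}"
    and "distinct gs" and "set gs = carrier H"
  shows "[group_det H gs (group_ring_elem H p x y z a)
            = (\<Sum>i<p. \<Sum>j<p. \<Sum>k<p. a i j k) ^ (p ^ 3)] (mod (int p ^ 3))"
proof -
  have p1: "p > 1" and odd: "odd p"
    using assms(2,3) by (auto simp: prime_gt_1_nat prime_odd_nat)
  have H: "group H" "finite (carrier H)" "card (carrier H) = p ^ 3"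
    using p1 by (simp_all add: H_def group_heisenberg finite_carrier_heisenberg card_carrier_heisenberg)
  have "g [^]\<^bsub>H\<^esub> p = \<one>\<^bsub>H\<^esub>" if "g \<in> carrier H" for g
    using heisenberg_power_eq_one[OF odd p1] that by (simp add: H_def)
  then have "[group_det H gs (group_ring_elem H p x y z a)
      = (\<Sum>g\<in>carrier H. group_ring_elem H p x y z a g) ^ (p ^ 3)] (mod (int p ^ 3))"
    using H assms by (intro group_det_cong_power) auto
  then show ?thesis
    by (simp only: sum_group_ring_elem[OF H(1,2) assms(4-6)])
qed

end
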